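(* Let $\Sigma$ be a connected graph, let $G\leqslant\mathrm{Aut}(\Sigma)$, and let $s$ be a positive integer such that $s\leqslant 2\,\mathrm{diam}(\Sigma)-1$ (so in particular $\mathrm{diam}(S(\Sigma))>s$). Then the subdivision graph $S(\Sigma)$ is locally $(G,s)$-distance transitive if and only if $\Sigma$ is $(G,\lceil\frac{s+1}{2}\rceil)$-arc transitive.
   Context: Graphs are simple and undirected; $V(\Sigma)$ and $E(\Sigma)$ denote the vertex set and edge set (edges are unordered pairs of vertices). The subdivision graph $S(\Sigma)$ has vertex set $V(\Sigma)\cup E(\Sigma)$ and edge set $\{\{x,e\}\mid x\in V(\Sigma), e\in E(\Sigma), x\in e\}$. $\mathrm{Aut}(\Sigma)$ acts naturally on $V(\Sigma)\cup E(\Sigma)$ preserving incidence, so $G\leqslant\mathrm{Aut}(\Sigma)$ acts on $S(\Sigma)$ by automorphisms. $\mathrm{diam}$ denotes the diameter (maximum distance between two vertices). For a graph $\Gamma$ and a positive integer $i$, an $i$-arc of $\Gamma$ is an $(i+1)$-tuple $(v_0,\dots,v_i)$ of vertices with $\{v_{j-1},v_j\}\in E(\Gamma)$ for $1\leqslant j\leqslant i$ and $v_{j-1}\ne v_{j+1}$ for $1\leqslant j\leqslant i-1$. $\Gamma_i(v)$ denotes the set of vertices at distance exactly $i$ from $v$. Let $G$ act on the connected graph $\Gamma$ by automorphisms. $\Gamma$ is $(G,t)$-arc transitive if $\Gamma$ has at least one $t$-arc and, for each $1\leqslant i\leqslant t$, $G$ is transitive on the set of $i$-arcs of $\Gamma$.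 $\Gamma$ is locally $(G,s)$-distance transitive if, for every vertex $v$ of $\Gamma$ and each $1\leqslant i\leqslant s$, the stabiliser $G_v$ is transitive on $\Gamma_i(v)$ (vacuously true if $\Gamma_i(v)=\emptyset$), and $\Gamma_s(v)\neq\emptyset$ for some vertex $v$. *)

theory Defs
  imports "HOL-Algebra.Group_Action" "HOL-Library.Extended_Nat"
begin

section \<open>Simple undirected graphs, not necessarily finite\<close>

record 'a graph =
  verts :: "'a set"
  edges :: "'a set set"

definition simple_graph :: "'a graph \<Rightarrow> bool" where
  "simple_graph \<Gamma> \<longleftrightarrow>
     (\<forall>e\<in>edges \<Gamma>. \<exists>u\<in>verts \<Gamma>. \<exists>v\<in>verts \<Gamma>. u \<noteq> v \<and> e = {u, v})"

text \<open>A walk is the nonempty list of its vertices; its length is the number of steps,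
  \<open>length p - 1\<close>.\<close>

definition walk :: "'a graph \<Rightarrow> 'a list \<Rightarrow> bool" where
  "walk \<Gamma> p \<longleftrightarrow> p \<noteq> [] \<and> set p \<subseteq> verts \<Gamma> \<and>
     (\<forall>j. Suc j < length p \<longrightarrow> {p ! j, p ! Suc j} \<in> edges \<Gamma>)"

definition connected_graph :: "'a graph \<Rightarrow> bool" where
  "connected_graph \<Gamma> \<longleftrightarrow> verts \<Gamma> \<noteq> {} \<and>
     (\<forall>u\<in>verts \<Gamma>. \<forall>v\<in>verts \<Gamma>. \<exists>p. walk \<Gamma> p \<and> hd p = u \<and> last p = v)"

definition gdist :: "'a graph \<Rightarrow> 'a \<Rightarrow> 'a \<Rightarrow> enat" where
  "gdist \<Gamma> u v = Inf {enat (length p - 1) |p. walk \<Gamma> p \<and> hd p = u \<and> last p = v}"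

text \<open>The diameter is \<open>\<infinity>\<close> when the distances are unbounded.\<close>

definition diam :: "'a graph \<Rightarrow> enat" where
  "diam \<Gamma> = Sup {gdist \<Gamma> u v |u v. u \<in> verts \<Gamma> \<and> v \<in> verts \<Gamma>}"

definition sphere :: "'a graph \<Rightarrow> nat \<Rightarrow> 'a \<Rightarrow> 'a set" where
  "sphere \<Gamma> i v = {w \<in> verts \<Gamma>. gdist \<Gamma> v w = enat i}"

definition arcs :: "'a graph \<Rightarrow> nat \<Rightarrow> 'a list set" where
  "arcs \<Gamma> i = {p. walk \<Gamma> p \<and> length p = i + 1 \<and>
     (\<forall>j. j + 2 < length p \<longrightarrow> p ! j \<noteq> p ! (j + 2))}"


section \<open>Automorphisms and the subdivision graph\<close>

definition Aut :: "'a graph \<Rightarrow> ('a \<Rightarrow> 'a) monoid" where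
  "Aut \<Gamma> = BijGroup (verts \<Gamma>)
     \<lparr>carrier := {f \<in> Bij (verts \<Gamma>). \<forall>u\<in>verts \<Gamma>. \<forall>v\<in>verts \<Gamma>.
        {f u, f v} \<in> edges \<Gamma> \<longleftrightarrow> {u, v} \<in> edges \<Gamma>}\<rparr>"

definition subdivision :: "'a graph \<Rightarrow> ('a + 'a set) graph" where
  "subdivision \<Sigma> =
     \<lparr>verts = verts \<Sigma> <+> edges \<Sigma>,
      edges = {{Inl x, Inr e} |x e. x \<in> verts \<Sigma> \<and> e \<in> edges \<Sigma> \<and> x \<in> e}\<rparr>"

text \<open>The natural action of automorphisms of \<open>\<Sigma>\<close> on the vertices of its subdivision graph,
  made extensional so that its values lie in \<^const>\<open>Bij\<close>; that it is an action by
  automorphisms is \<open>subdivision_act_hom\<close> below.\<close>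

definition subdivision_act :: "'a graph \<Rightarrow> ('a \<Rightarrow> 'a) \<Rightarrow> 'a + 'a set \<Rightarrow> 'a + 'a set" where
  "subdivision_act \<Sigma> g = restrict (map_sum g (image g)) (verts (subdivision \<Sigma>))"


section \<open>Symmetry conditions\<close>

text \<open>Here \<open>G\<close> is a group acting on \<open>\<Gamma>\<close> by automorphisms via \<open>\<phi>\<close>.\<close>

definition transitive_on :: "'g set \<Rightarrow> ('g \<Rightarrow> 'b \<Rightarrow> 'b) \<Rightarrow> 'b set \<Rightarrow> bool" where
  "transitive_on H \<phi> A \<longleftrightarrow> (\<forall>x\<in>A. \<forall>y\<in>A. \<exists>g\<in>H. \<phi> g x = y)"

definition arc_transitive ::
  "('g, 'c) monoid_scheme \<Rightarrow> ('g \<Rightarrow> 'a \<Rightarrow> 'a) \<Rightarrow> 'a graph \<Rightarrow> nat \<Rightarrow> bool" where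
  "arc_transitive G \<phi> \<Gamma> t \<longleftrightarrow> arcs \<Gamma> t \<noteq> {} \<and>
     (\<forall>i\<in>{1..t}. transitive_on (carrier G) (\<lambda>g. map (\<phi> g)) (arcs \<Gamma> i))"

definition locally_distance_transitive ::
  "('g, 'c) monoid_scheme \<Rightarrow> ('g \<Rightarrow> 'a \<Rightarrow> 'a) \<Rightarrow> 'a graph \<Rightarrow> nat \<Rightarrow> bool" where
  "locally_distance_transitive G \<phi> \<Gamma> s \<longleftrightarrow>
     (\<forall>v\<in>verts \<Gamma>. \<forall>i\<in>{1..s}. transitive_on (stabilizer G \<phi> v) \<phi> (sphere \<Gamma> i v)) \<and>
     (\<exists>v\<in>verts \<Gamma>. sphere \<Gamma> s v \<noteq> {})"


section \<open>The actions are by automorphisms\<close>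

lemma Aut_subgroup: "subgroup (carrier (Aut \<Gamma>)) (BijGroup (verts \<Gamma>))"
proof (intro group.subgroupI group_BijGroup)
  let ?V = "verts \<Gamma>"
  let ?B = "BijGroup ?V"
  have mem: "f \<in> carrier (Aut \<Gamma>) \<longleftrightarrow> f \<in> Bij ?V \<and>
      (\<forall>u\<in>?V. \<forall>v\<in>?V. {f u, f v} \<in> edges \<Gamma> \<longleftrightarrow> {u, v} \<in> edges \<Gamma>)" for f
    by (simp add: Aut_def)
  have closed: "f x \<in> ?V" if "f \<in> Bij ?V" "x \<in> ?V" for f x
    using Bij_imp_funcset[OF that(1)] that(2) by auto
  show "carrier (Aut \<Gamma>) \<subseteq> carrier ?B"
    by (auto simp: mem BijGroup_def)
  have "(\<lambda>x\<in>?V. x) \<in> carrier (Aut \<Gamma>)"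
    unfolding mem using id_Bij by auto
  then show "carrier (Aut \<Gamma>) \<noteq> {}"
    by blast
  fix f assume f: "f \<in> carrier (Aut \<Gamma>)"
  then have fB: "f \<in> Bij ?V"
    by (simp add: mem)
  then have surj: "f ` ?V = ?V"
    by (simp add: Bij_def bij_betw_def)
  have "{inv_into ?V f u, inv_into ?V f v} \<in> edges \<Gamma> \<longleftrightarrow> {u, v} \<in> edges \<Gamma>"
    if "u \<in> ?V" "v \<in> ?V" for u v
  proof -
    have "{f (inv_into ?V f u), f (inv_into ?V f v)} \<in> edges \<Gamma> \<longleftrightarrow>
        {inv_into ?V f u, inv_into ?V f v} \<in> edges \<Gamma>"
      using f that Bij_inv_into_mem[OF fB] by (simp add: mem)
    then show ?thesis
      using that surj by (simp add: f_inv_into_f)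
  qed
  then show "inv\<^bsub>?B\<^esub> f \<in> carrier (Aut \<Gamma>)"
    using fB restrict_inv_into_Bij[OF fB] by (simp add: inv_BijGroup mem)
  fix g assume g: "g \<in> carrier (Aut \<Gamma>)"
  then have gB: "g \<in> Bij ?V"
    by (simp add: mem)
  show "f \<otimes>\<^bsub>?B\<^esub> g \<in> carrier (Aut \<Gamma>)"
    using f g closed[OF gB] compose_Bij[OF fB gB]
    by (simp add: mem BijGroup_def compose_def)
qed

lemma group_Aut: "group (Aut \<Gamma>)"
  using subgroup.subgroup_is_group[OF Aut_subgroup group_BijGroup]
  by (simp add: Aut_def)

lemma subdivision_act_hom:
  assumes "simple_graph \<Sigma>"
  shows "subdivision_act \<Sigma> \<in> hom (Aut \<Sigma>) (Aut (subdivision \<Sigma>))"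
proof -
  let ?V = "verts \<Sigma>" and ?E = "edges \<Sigma>"
  let ?W = "?V <+> ?E"
  have W: "verts (subdivision \<Sigma>) = ?W"
    by (simp add: subdivision_def)
  have E_sub: "e \<subseteq> ?V" if "e \<in> ?E" for e
    using assms that by (fastforce simp: simple_graph_def)
  have edge_img: "g ` e \<in> ?E" if "g \<in> carrier (Aut \<Sigma>)" "e \<in> ?E" for g e
  proof -
    obtain u v where "u \<in> ?V" "v \<in> ?V" "e = {u, v}"
      using assms \<open>e \<in> ?E\<close> by (auto simp: simple_graph_def)
    then show ?thesis
      using that by (auto simp: Aut_def)
  qed
  have bij: "bij_betw g ?V ?V" if "g \<in> carrier (Aut \<Sigma>)" for g
    using that by (simp add: Aut_def Bij_def)
  have act_closed: "subdivision_act \<Sigma> g z \<in> ?W" if "g \<in> carrier (Aut \<Sigma>)" "z \<in> ?W" for g z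
    using that bij[OF that(1)] edge_img[OF that(1)]
    by (auto simp: subdivision_act_def W bij_betw_def)
  have comp: "subdivision_act \<Sigma> (compose ?V f g)
      = compose ?W (subdivision_act \<Sigma> f) (subdivision_act \<Sigma> g)"
    if "f \<in> carrier (Aut \<Sigma>)" "g \<in> carrier (Aut \<Sigma>)" for f g
  proof
    fix z
    show "subdivision_act \<Sigma> (compose ?V f g) z
        = compose ?W (subdivision_act \<Sigma> f) (subdivision_act \<Sigma> g) z"
    proof (cases "z \<in> ?W")
      case False
      then show ?thesis by (simp add: subdivision_act_def W compose_def InlI InrI)
    next
      case True
      then show ?thesis
      proof (cases z)
        case (Inl x)
        then have "x \<in> ?V" "g x \<in> ?V"
          using True bij[OF that(2)] by (auto simp: bij_betw_def)
        then show ?thesis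
          using Inl by (simp add: subdivision_act_def W compose_def InlI InrI)
      next
        case (Inr e)
        then have e: "e \<in> ?E" "g ` e \<in> ?E"
          using True edge_img[OF that(2)] by auto
        have "compose ?V f g ` e = f ` g ` e"
          unfolding image_image by (rule image_cong) (use E_sub[OF e(1)] in \<open>auto simp: compose_def\<close>)
        then show ?thesis
          using Inr e by (simp add: subdivision_act_def W compose_def InlI InrI)
      qed
    qed
  qed
  have inj: "inj_on (subdivision_act \<Sigma> g) ?W" if "g \<in> carrier (Aut \<Sigma>)" for g
  proof (rule inj_onI)
    fix y z assume yz: "y \<in> ?W" "z \<in> ?W" and eq: "subdivision_act \<Sigma> g y = subdivision_act \<Sigma> g z"
    have "inj_on g ?V"
      using bij[OF that] by (simp add: bij_betw_def)
    then show "y = z"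
      using yz eq E_sub
      by (auto simp: subdivision_act_def W inj_on_eq_iff inj_on_image_eq_iff)
  qed
  have surj: "subdivision_act \<Sigma> g ` ?W = ?W" if g: "g \<in> carrier (Aut \<Sigma>)" for g
  proof
    show "subdivision_act \<Sigma> g ` ?W \<subseteq> ?W"
      using act_closed[OF g] by blast
    show "?W \<subseteq> subdivision_act \<Sigma> g ` ?W"
    proof
      fix z assume z: "z \<in> ?W"
      interpret group "Aut \<Sigma>" by (rule group_Aut)
      let ?h = "inv\<^bsub>Aut \<Sigma>\<^esub> g"
      have h: "?h \<in> carrier (Aut \<Sigma>)"
        using g by simp
      have B: "g \<in> Bij ?V" "?h \<in> Bij ?V"
        using g h by (auto simp: Aut_def)
      have "g \<otimes>\<^bsub>Aut \<Sigma>\<^esub> ?h = \<one>\<^bsub>Aut \<Sigma>\<^esub>"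
        using g by simp
      then have "compose ?V g ?h = (\<lambda>x\<in>?V. x)"
        using B by (simp add: Aut_def BijGroup_def)
      then have "subdivision_act \<Sigma> (\<lambda>x\<in>?V. x) z = subdivision_act \<Sigma> g (subdivision_act \<Sigma> ?h z)"
        using comp[OF g h] z by (simp add: compose_def)
      moreover have "subdivision_act \<Sigma> (\<lambda>x\<in>?V. x) z = z"
      proof (cases z)
        case (Inr e)
        then have e: "e \<in> ?E"
          using z by auto
        have "(\<lambda>x\<in>?V. x) ` e = e"
          using E_sub[OF e] by (auto simp: image_iff subset_iff)
        then show ?thesis
          using Inr e by (simp add: subdivision_act_def W InrI)
      qed (use z in \<open>auto simp: subdivision_act_def W\<close>)
      ultimately show "z \<in> subdivision_act \<Sigma> g ` ?W"
        using act_closed[OF h z] by (metis image_eqI)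
    qed
  qed
  have act_Bij: "subdivision_act \<Sigma> g \<in> Bij ?W" if "g \<in> carrier (Aut \<Sigma>)" for g
    using inj[OF that] surj[OF that] by (auto simp: Bij_def bij_betw_def subdivision_act_def W)
  have inc: "{Inl x, Inr e} \<in> edges (subdivision \<Sigma>) \<longleftrightarrow> x \<in> ?V \<and> e \<in> ?E \<and> x \<in> e" for x e
    by (auto simp: subdivision_def doubleton_eq_iff)
  have ninc: "{Inl x, Inl y} \<notin> edges (subdivision \<Sigma>)" "{Inr e, Inr f} \<notin> edges (subdivision \<Sigma>)"
    for x y e f
    by (auto simp: subdivision_def doubleton_eq_iff)
  have act_edge: "{subdivision_act \<Sigma> g y, subdivision_act \<Sigma> g z} \<in> edges (subdivision \<Sigma>)
      \<longleftrightarrow> {y, z} \<in> edges (subdivision \<Sigma>)"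
    if g: "g \<in> carrier (Aut \<Sigma>)" and yz: "y \<in> ?W" "z \<in> ?W" for g y z
  proof -
    have key: "{Inl (g x), Inr (g ` e)} \<in> edges (subdivision \<Sigma>)
        \<longleftrightarrow> {Inl x, Inr e} \<in> edges (subdivision \<Sigma>)" if "x \<in> ?V" "e \<in> ?E" for x e
    proof -
      have "g x \<in> g ` e \<longleftrightarrow> x \<in> e"
        using bij[OF g] E_sub[OF that(2)] that(1) by (auto simp: bij_betw_def dest: inj_on_image_mem_iff)
      then show ?thesis
        using that edge_img[OF g that(2)] bij[OF g] by (auto simp: inc bij_betw_def)
    qed
    show ?thesis
    proof (cases y; cases z)
      fix x e assume "y = Inl x" "z = Inr e"
      then have "x \<in> ?V" "e \<in> ?E"
        using yz by auto
      then show ?thesis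
        using \<open>y = _\<close> \<open>z = _\<close> key by (simp add: subdivision_act_def W InlI InrI)
    next
      fix x e assume "y = Inr e" "z = Inl x"
      then have "x \<in> ?V" "e \<in> ?E"
        using yz by auto
      then show ?thesis
        using \<open>y = _\<close> \<open>z = _\<close> key by (simp add: subdivision_act_def W InlI InrI insert_commute)
    qed (use yz in \<open>auto simp: subdivision_act_def W ninc\<close>)
  qed
  have closed: "subdivision_act \<Sigma> g \<in> carrier (Aut (subdivision \<Sigma>))"
    if "g \<in> carrier (Aut \<Sigma>)" for g
    using act_Bij[OF that] act_edge[OF that] by (simp add: Aut_def W)
  moreover have "subdivision_act \<Sigma> (f \<otimes>\<^bsub>Aut \<Sigma>\<^esub> g)
      = subdivision_act \<Sigma> f \<otimes>\<^bsub>Aut (subdivision \<Sigma>)\<^esub> subdivision_act \<Sigma> g"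
    if "f \<in> carrier (Aut \<Sigma>)" "g \<in> carrier (Aut \<Sigma>)" for f g
  proof -
    have "f \<in> Bij ?V" "g \<in> Bij ?V"
      using that by (auto simp: Aut_def)
    then show ?thesis
      using comp[OF that] act_Bij[OF that(1)] act_Bij[OF that(2)]
      by (simp add: Aut_def BijGroup_def W)
  qed
  ultimately show ?thesis
    by (auto simp: hom_def)
qed

end

theory Submission
  imports Defs
begin

text \<open>Write \<open>S\<close> for the subdivision graph and \<open>t = s div 2 + 1\<close>, which is \<open>\<lceil>(s + 1) / 2\<rceil>\<close>. Distances
  between vertices of \<open>\<Sigma>\<close> double in \<open>S\<close>, and an edge of \<open>\<Sigma>\<close> is one step further from any other
  vertex of \<open>S\<close> than its nearer end.

  Arc-transitivity gives distance-transitivity because a geodesic of length \<open>i \<le> s\<close> in \<open>S\<close> runs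
  along an arc of \<open>\<Sigma>\<close> of length at most \<open>t\<close> that determines both of its ends
  (\<open>geodesic_subdivision_arc\<close>). Two geodesics from the same vertex \<open>v\<close> with the same length yield
  arcs of equal length, and an automorphism taking one arc to the other fixes \<open>v\<close> and takes one
  final vertex to the other.

  Conversely, distance \<open>1\<close> in \<open>S\<close> already gives transitivity on \<open>1\<close>-arcs: one can turn around each
  vertex, reverse each edge, and \<open>\<Sigma>\<close> is connected. The step from \<open>i\<close>-arcs to \<open>(i + 1)\<close>-arcs, for
  \<open>i < t\<close>, uses distance \<open>2 i \<le> s\<close> between edges (\<open>arc_transitive_Suc\<close>). It works because the
  bound on \<open>s\<close> means that \<open>t\<close> is at most the diameter of \<open>\<Sigma>\<close>, so that there is a geodesic of
  length \<open>i + 1\<close>. By transitivity on shorter arcs all arcs of length at most \<open>i\<close> are then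
  geodesics, so that arcs of length less than \<open>i\<close> are determined by their ends
  (\<open>arcs_eq_if_geodesic\<close>). An element fixing the first edge and matching the last edges of a
  geodesic and an arbitrary arc of length \<open>i + 1\<close> must therefore match the arcs themselves.\<close>


section \<open>Walks and distances\<close>

definition step :: "'a graph \<Rightarrow> ('a \<times> 'a) set" where
  "step \<Gamma> = {(u, v). u \<in> verts \<Gamma> \<and> v \<in> verts \<Gamma> \<and> {u, v} \<in> edges \<Gamma>}"

text \<open>In a connected graph this is \<^const>\<open>gdist\<close> as a natural number.\<close>

definition hop :: "'a graph \<Rightarrow> 'a \<Rightarrow> 'a \<Rightarrow> nat" where
  "hop \<Gamma> u v = (LEAST n. (u, v) \<in> step \<Gamma> ^^ n)"

lemma relpow_step_iff_walk:
  assumes "u \<in> verts \<Gamma>"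
  shows "(u, w) \<in> step \<Gamma> ^^ n \<longleftrightarrow>
    (\<exists>p. walk \<Gamma> p \<and> length p = Suc n \<and> hd p = u \<and> last p = w)"
proof
  assume "(u, w) \<in> step \<Gamma> ^^ n"
  then obtain f where f: "f 0 = u" "f n = w" "\<And>i. i < n \<Longrightarrow> (f i, f (Suc i)) \<in> step \<Gamma>"
    by (auto simp: relpow_fun_conv)
  have V: "f i \<in> verts \<Gamma>" if "i \<le> n" for i
    using that assms f(1) f(3)[of "i - 1"] by (cases i) (auto simp: step_def)
  let ?p = "map f [0..<Suc n]"
  have "walk \<Gamma> ?p"
    using f(3) V unfolding walk_def by (auto simp: step_def nth_append simp del: upt_Suc)
  moreover have "hd ?p = u" "last ?p = w"
    using f by (simp_all add: hd_map last_map del: upt_Suc)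
  ultimately show "\<exists>p. walk \<Gamma> p \<and> length p = Suc n \<and> hd p = u \<and> last p = w"
    by (intro exI[of _ ?p]) auto
next
  assume "\<exists>p. walk \<Gamma> p \<and> length p = Suc n \<and> hd p = u \<and> last p = w"
  then obtain p where p: "walk \<Gamma> p" "length p = Suc n" "hd p = u" "last p = w"
    by blast
  then have "p ! 0 = u" "p ! n = w" "\<forall>i<n. (p ! i, p ! Suc i) \<in> step \<Gamma>"
    by (auto simp: hd_conv_nth last_conv_nth walk_def step_def subset_iff)
  then show "(u, w) \<in> step \<Gamma> ^^ n"
    unfolding relpow_fun_conv by (intro exI[of _ "(!) p"]) auto
qed

lemma connected_graph_iff:
  "connected_graph \<Gamma> \<longleftrightarrow> verts \<Gamma> \<noteq> {} \<and>
    (\<forall>u\<in>verts \<Gamma>. \<forall>v\<in>verts \<Gamma>. (u, v) \<in> (step \<Gamma>)\<^sup>*)"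
proof -
  have "(\<exists>p. walk \<Gamma> p \<and> hd p = u \<and> last p = v) \<longleftrightarrow> (u, v) \<in> (step \<Gamma>)\<^sup>*"
    if "u \<in> verts \<Gamma>" for u v
  proof -
    have "(\<exists>p. walk \<Gamma> p \<and> hd p = u \<and> last p = v) \<longleftrightarrow> (\<exists>n. (u, v) \<in> step \<Gamma> ^^ n)"
    proof
      assume "\<exists>p. walk \<Gamma> p \<and> hd p = u \<and> last p = v"
      then obtain p where p: "walk \<Gamma> p" "hd p = u" "last p = v"
        by blast
      then have "length p = Suc (length p - 1)"
        by (auto simp: walk_def)
      then show "\<exists>n. (u, v) \<in> step \<Gamma> ^^ n"
        using p relpow_step_iff_walk[OF that] by blast
    qed (auto simp: relpow_step_iff_walk[OF that])
    then show ?thesis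
      by (simp add: rtrancl_power)
  qed
  then show ?thesis
    by (auto simp: connected_graph_def)
qed

lemma hop_le: "(u, v) \<in> step \<Gamma> ^^ n \<Longrightarrow> hop \<Gamma> u v \<le> n"
  unfolding hop_def by (rule Least_le)

lemma hop_attained:
  assumes "connected_graph \<Gamma>" "u \<in> verts \<Gamma>" "v \<in> verts \<Gamma>"
  shows "(u, v) \<in> step \<Gamma> ^^ hop \<Gamma> u v"
  unfolding hop_def
  by (rule LeastI_ex) (use assms in \<open>auto simp: connected_graph_iff rtrancl_power\<close>)

lemma gdist_eq_hop:
  assumes "connected_graph \<Gamma>" "u \<in> verts \<Gamma>" "v \<in> verts \<Gamma>"
  shows "gdist \<Gamma> u v = enat (hop \<Gamma> u v)"
proof -
  have "{enat (length p - 1) |p. walk \<Gamma> p \<and> hd p = u \<and> last p = v}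
      = enat ` {n. (u, v) \<in> step \<Gamma> ^^ n}"
  proof -
    have "length p = Suc (length p - 1)" if "walk \<Gamma> p" for p
      using that by (auto simp: walk_def)
    then show ?thesis
      unfolding relpow_step_iff_walk[OF assms(2)] by force
  qed
  also have "Inf \<dots> = enat (hop \<Gamma> u v)"
    using hop_attained[OF assms] by (intro antisym Inf_lower Inf_greatest) (auto intro: hop_le)
  finally show ?thesis
    by (simp add: gdist_def)
qed

lemma sphere_iff_hop:
  assumes "connected_graph \<Gamma>" "v \<in> verts \<Gamma>"
  shows "w \<in> sphere \<Gamma> i v \<longleftrightarrow> w \<in> verts \<Gamma> \<and> hop \<Gamma> v w = i"
  using gdist_eq_hop[OF assms, of w] by (auto simp: sphere_def)

lemma hop_self [simp]: "hop \<Gamma> u u = 0"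
  using hop_le[of u u 0 \<Gamma>] by simp

lemma hop_eq_0_iff:
  assumes "connected_graph \<Gamma>" "u \<in> verts \<Gamma>" "v \<in> verts \<Gamma>"
  shows "hop \<Gamma> u v = 0 \<longleftrightarrow> u = v"
  using hop_attained[OF assms] by (cases "hop \<Gamma> u v = 0") auto

lemma step_sym: "(u, v) \<in> step \<Gamma> \<Longrightarrow> (v, u) \<in> step \<Gamma>"
  by (auto simp: step_def insert_commute)

lemma relpow_step_sym: "(u, v) \<in> step \<Gamma> ^^ n \<Longrightarrow> (v, u) \<in> step \<Gamma> ^^ n"
proof (induction n arbitrary: v)
  case (Suc n)
  then show ?case
    by (meson relpow_Suc_E relpow_Suc_I2 step_sym)
qed simp

lemma hop_sym: "hop \<Gamma> u v = hop \<Gamma> v u"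
  unfolding hop_def by (metis relpow_step_sym)

lemma hop_triangle:
  assumes "connected_graph \<Gamma>" "u \<in> verts \<Gamma>" "v \<in> verts \<Gamma>" "w \<in> verts \<Gamma>"
  shows "hop \<Gamma> u w \<le> hop \<Gamma> u v + hop \<Gamma> v w"
  using hop_attained[of \<Gamma> u v] hop_attained[of \<Gamma> v w] assms
  by (intro hop_le) (auto simp: relpow_add)

lemma hop_step: "(u, v) \<in> step \<Gamma> \<Longrightarrow> hop \<Gamma> u v \<le> 1"
  by (rule hop_le) simp


section \<open>Arcs\<close>

lemma arcs_iff:
  "p \<in> arcs \<Gamma> n \<longleftrightarrow> length p = Suc n \<and> set p \<subseteq> verts \<Gamma> \<and>
    (\<forall>j<n. {p ! j, p ! Suc j} \<in> edges \<Gamma>) \<and> (\<forall>j. j + 2 \<le> n \<longrightarrow> p ! j \<noteq> p ! (j + 2))"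
  by (auto simp: arcs_def walk_def)

lemma arcs_nth_mem: "p \<in> arcs \<Gamma> n \<Longrightarrow> j \<le> n \<Longrightarrow> p ! j \<in> verts \<Gamma>"
  by (auto simp: arcs_iff subset_iff)

lemma arcs_segment:
  assumes "p \<in> arcs \<Gamma> n" "i + k \<le> n"
  shows "take (Suc k) (drop i p) \<in> arcs \<Gamma> k"
  unfolding arcs_iff
proof (intro conjI allI impI)
  fix j
  show "j < k \<Longrightarrow> {take (Suc k) (drop i p) ! j, take (Suc k) (drop i p) ! Suc j} \<in> edges \<Gamma>"
    using assms by (simp add: arcs_iff)
  assume "j + 2 \<le> k"
  then have "p ! (i + j) \<noteq> p ! (i + j + 2)"
    using assms by (simp add: arcs_iff)
  then show "take (Suc k) (drop i p) ! j \<noteq> take (Suc k) (drop i p) ! (j + 2)"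
    using \<open>j + 2 \<le> k\<close> assms by (simp add: arcs_iff add.assoc)
qed (use assms in \<open>auto simp: arcs_iff dest!: in_set_takeD in_set_dropD\<close>)

lemma arcs_snoc:
  assumes "p \<in> arcs \<Gamma> n" "w \<in> verts \<Gamma>" "{p ! n, w} \<in> edges \<Gamma>"
    and "n > 0 \<Longrightarrow> w \<noteq> p ! (n - 1)"
  shows "p @ [w] \<in> arcs \<Gamma> (Suc n)"
  unfolding arcs_iff
proof (intro conjI allI impI)
  fix j assume j: "j + 2 \<le> Suc n"
  show "(p @ [w]) ! j \<noteq> (p @ [w]) ! (j + 2)"
  proof (cases "j + 2 \<le> n")
    case True
    then show ?thesis using assms(1) by (auto simp: arcs_iff nth_append)
  next
    case False
    then have "n = Suc j" using j by simp
    then show ?thesis using assms(1,4) by (auto simp: arcs_iff nth_append)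
  qed
qed (use assms in \<open>auto simp: arcs_iff nth_append less_Suc_eq\<close>)

lemma arcs_rev:
  assumes "p \<in> arcs \<Gamma> n"
  shows "rev p \<in> arcs \<Gamma> n"
  unfolding arcs_iff
proof (intro conjI allI impI)
  have len: "length p = Suc n" using assms by (simp add: arcs_iff)
  fix j
  { assume "j < n"
    then have "{p ! (n - Suc j), p ! Suc (n - Suc j)} \<in> edges \<Gamma>"
      using assms by (auto simp: arcs_iff)
    then show "{rev p ! j, rev p ! Suc j} \<in> edges \<Gamma>"
      using len \<open>j < n\<close> by (simp add: rev_nth insert_commute Suc_diff_Suc) }
  assume "j + 2 \<le> n"
  then have "p ! (n - (j + 2)) \<noteq> p ! (n - (j + 2) + 2)"
    using assms by (simp add: arcs_iff)
  moreover have "n - (j + 2) + 2 = n - j" using \<open>j + 2 \<le> n\<close> by simp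
  moreover have "rev p ! j = p ! (n - j)" "rev p ! (j + 2) = p ! (n - (j + 2))"
    using len \<open>j + 2 \<le> n\<close> by (simp_all add: rev_nth)
  ultimately show "rev p ! j \<noteq> rev p ! (j + 2)"
    by simp
qed (use assms in \<open>auto simp: arcs_iff\<close>)

lemma arcs_Cons:
  assumes "p \<in> arcs \<Gamma> n" "w \<in> verts \<Gamma>" "{w, p ! 0} \<in> edges \<Gamma>"
    and "n > 0 \<Longrightarrow> w \<noteq> p ! 1"
  shows "w # p \<in> arcs \<Gamma> (Suc n)"
proof -
  have "length p = Suc n" using assms(1) by (simp add: arcs_iff)
  then have "rev p @ [w] \<in> arcs \<Gamma> (Suc n)"
    using assms by (intro arcs_snoc arcs_rev) (auto simp: rev_nth insert_commute)
  then show ?thesis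
    using arcs_rev by fastforce
qed

lemma hop_arc_le:
  assumes "p \<in> arcs \<Gamma> n" "i \<le> j" "j \<le> n"
  shows "hop \<Gamma> (p ! i) (p ! j) \<le> j - i"
proof (rule hop_le)
  show "(p ! i, p ! j) \<in> step \<Gamma> ^^ (j - i)"
    unfolding relpow_fun_conv
  proof (intro exI[of _ "\<lambda>k. p ! (i + k)"] conjI allI impI)
    fix k assume "k < j - i"
    then show "(p ! (i + k), p ! (i + Suc k)) \<in> step \<Gamma>"
      using assms arcs_nth_mem[OF assms(1)] by (auto simp: step_def arcs_iff)
  qed (use assms in auto)
qed

text \<open>The distance from the start grows by one along a shortest walk, so two of its vertices
  never agree.\<close>

lemma geodesic_arc_exists:
  assumes "connected_graph \<Gamma>" "u \<in> verts \<Gamma>" "w \<in> verts \<Gamma>"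
  obtains p where "p \<in> arcs \<Gamma> (hop \<Gamma> u w)" "p ! 0 = u" "p ! hop \<Gamma> u w = w"
    and "\<And>k. k \<le> hop \<Gamma> u w \<Longrightarrow> hop \<Gamma> u (p ! k) = k"
    and "\<And>k. k \<le> hop \<Gamma> u w \<Longrightarrow> hop \<Gamma> (p ! k) w = hop \<Gamma> u w - k"
proof -
  define n where "n = hop \<Gamma> u w"
  obtain p where p: "walk \<Gamma> p" "length p = Suc n" "hd p = u" "last p = w"
    using hop_attained[OF assms] relpow_step_iff_walk[OF assms(2)] unfolding n_def by blast
  have ends: "p ! 0 = u" "p ! n = w"
    using p by (auto simp: hd_conv_nth last_conv_nth walk_def)
  have V: "p ! k \<in> verts \<Gamma>" if "k \<le> n" for k
    using p that by (auto simp: walk_def subset_iff)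
  have st: "(p ! k, p ! Suc k) \<in> step \<Gamma>" if "k < n" for k
    using p that V[of k] V[of "Suc k"] by (auto simp: walk_def step_def)
  have le: "hop \<Gamma> (p ! i) (p ! j) \<le> j - i" if "i \<le> j" "j \<le> n" for i j
    by (rule hop_le, unfold relpow_fun_conv, rule exI[of _ "\<lambda>k. p ! (i + k)"])
      (use that st in auto)
  have hu: "hop \<Gamma> u (p ! k) = k" and hw: "hop \<Gamma> (p ! k) w = n - k" if "k \<le> n" for k
    using le[of 0 k] le[of k n] that ends hop_triangle[OF assms(1,2) V[OF that] assms(3)]
    by (auto simp: n_def)
  have "p \<in> arcs \<Gamma> n"
    unfolding arcs_iff
  proof (intro conjI allI impI)
    fix j assume "j + 2 \<le> n"
    then show "p ! j \<noteq> p ! (j + 2)"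
      using hu[of j] hu[of "j + 2"] by auto
  qed (use p in \<open>auto simp: walk_def\<close>)
  then show thesis
    using that[of p] ends hu hw by (simp add: n_def)
qed

lemma geodesic_of_length_exists:
  assumes "connected_graph \<Gamma>" "enat n \<le> diam \<Gamma>"
  obtains u w where "u \<in> verts \<Gamma>" "w \<in> verts \<Gamma>" "hop \<Gamma> u w = n"
proof -
  have "\<exists>u\<in>verts \<Gamma>. \<exists>w\<in>verts \<Gamma>. n \<le> hop \<Gamma> u w"
  proof (rule ccontr)
    assume *: "\<not> ?thesis"
    then have lt: "hop \<Gamma> u w < n" if "u \<in> verts \<Gamma>" "w \<in> verts \<Gamma>" for u w
      using that by (meson not_le)
    then have "diam \<Gamma> \<le> enat (n - 1)"
      unfolding diam_def
      by (intro Sup_least) (fastforce simp: gdist_eq_hop[OF assms(1)])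
    moreover have "n > 0"
      using lt assms(1) by (fastforce simp: connected_graph_def)
    ultimately show False
      using order_trans[OF assms(2), of "enat (n - 1)"] by simp
  qed
  then obtain u w where uw: "u \<in> verts \<Gamma>" "w \<in> verts \<Gamma>" "n \<le> hop \<Gamma> u w"
    by blast
  obtain p where "p \<in> arcs \<Gamma> (hop \<Gamma> u w)" "\<And>k. k \<le> hop \<Gamma> u w \<Longrightarrow> hop \<Gamma> u (p ! k) = k"
    using geodesic_arc_exists[OF assms(1) uw(1,2)] by blast
  then show thesis
    using that[of u "p ! n"] uw arcs_nth_mem[of p \<Gamma> _ n] by blast
qed

text \<open>Two different walks from \<open>x\<close> to \<open>y\<close> of the same length would differ in the vertex before
  some common vertex; going along one of them and stepping back along the other is an arc that
  returns towards \<open>x\<close>, hence is not a geodesic.\<close>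

lemma arcs_eq_if_geodesic:
  assumes "\<And>k p. k \<le> Suc n \<Longrightarrow> p \<in> arcs \<Gamma> k \<Longrightarrow> hop \<Gamma> (p ! 0) (p ! k) = k"
    and "p \<in> arcs \<Gamma> n" "q \<in> arcs \<Gamma> n" "p ! 0 = q ! 0" "p ! n = q ! n"
  shows "p = q"
  using assms
proof (induction n arbitrary: p q)
  case 0
  then show ?case
    by (auto simp: arcs_iff length_Suc_conv)
next
  case (Suc n)
  have len: "length p = Suc (Suc n)" "length q = Suc (Suc n)"
    using Suc.prems by (auto simp: arcs_iff)
  have "p ! n = q ! n"
  proof (rule ccontr)
    assume "p ! n \<noteq> q ! n"
    then have "p @ [q ! n] \<in> arcs \<Gamma> (Suc (Suc n))"
      using Suc.prems by (intro arcs_snoc) (auto simp: arcs_nth_mem arcs_iff insert_commute)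
    from Suc.prems(1)[OF _ this] have "hop \<Gamma> (p ! 0) (q ! n) = Suc (Suc n)"
      using len by (simp add: nth_append)
    moreover have "hop \<Gamma> (q ! 0) (q ! n) \<le> n"
      using hop_arc_le[OF Suc.prems(3), of 0 n] by simp
    ultimately show False
      using Suc.prems(4) by simp
  qed
  moreover have "take (Suc n) p \<in> arcs \<Gamma> n" "take (Suc n) q \<in> arcs \<Gamma> n"
    using arcs_segment[of _ \<Gamma> "Suc n" 0 n] Suc.prems by auto
  ultimately have "take (Suc n) p = take (Suc n) q"
    using Suc.prems by (intro Suc.IH) auto
  moreover have "p = take (Suc n) p @ [p ! Suc n]" "q = take (Suc n) q @ [q ! Suc n]"
    using len by (simp_all add: take_Suc_conv_app_nth[symmetric])
  ultimately show ?case
    using Suc.prems(5) by metis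
qed


section \<open>Distances in the subdivision graph\<close>

lemma verts_subdivision [simp]:
  "Inl x \<in> verts (subdivision \<Sigma>) \<longleftrightarrow> x \<in> verts \<Sigma>"
  "Inr e \<in> verts (subdivision \<Sigma>) \<longleftrightarrow> e \<in> edges \<Sigma>"
  by (auto simp: subdivision_def)

lemma step_subdivision:
  "(Inl x, Inr e) \<in> step (subdivision \<Sigma>) \<longleftrightarrow> x \<in> verts \<Sigma> \<and> e \<in> edges \<Sigma> \<and> x \<in> e"
  "(Inr e, Inl x) \<in> step (subdivision \<Sigma>) \<longleftrightarrow> x \<in> verts \<Sigma> \<and> e \<in> edges \<Sigma> \<and> x \<in> e"
  "(Inl x, Inl y) \<notin> step (subdivision \<Sigma>)"
  "(Inr e, Inr f) \<notin> step (subdivision \<Sigma>)"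
  by (auto simp: step_def subdivision_def doubleton_eq_iff)

lemma simple_graph_edgeE:
  assumes "simple_graph \<Sigma>" "e \<in> edges \<Sigma>"
  obtains u w where "e = {u, w}" "u \<in> verts \<Sigma>" "w \<in> verts \<Sigma>" "u \<noteq> w"
  using assms unfolding simple_graph_def by blast

lemma simple_graph_edge_otherE:
  assumes "simple_graph \<Sigma>" "e \<in> edges \<Sigma>" "a \<in> e"
  obtains b where "e = {a, b}"
  by (rule simple_graph_edgeE[OF assms(1,2)]) (use assms(3) that in blast)

lemma simple_graph_edgeD:
  assumes "simple_graph \<Sigma>" "{u, w} \<in> edges \<Sigma>"
  shows "u \<in> verts \<Sigma>" "w \<in> verts \<Sigma>" "u \<noteq> w"
  using simple_graph_edgeE[OF assms] by (auto simp: doubleton_eq_iff)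

lemma relpow_step_subdivision:
  assumes "(x, y) \<in> step \<Sigma> ^^ n"
  shows "(Inl x, Inl y) \<in> step (subdivision \<Sigma>) ^^ (2 * n)"
  using assms
proof (induction n arbitrary: y)
  case (Suc n)
  then obtain z where "(Inl x, Inl z) \<in> step (subdivision \<Sigma>) ^^ (2 * n)" "(z, y) \<in> step \<Sigma>"
    by auto
  moreover from this(2) have "(Inl z, Inr {z, y}) \<in> step (subdivision \<Sigma>)"
    "(Inr {z, y}, Inl y) \<in> step (subdivision \<Sigma>)"
    by (simp_all add: step_subdivision) (auto simp: step_def)
  ultimately show ?case
    by auto
qed simp

text \<open>Two consecutive steps from a vertex of \<open>\<Sigma>\<close> either return to it or lead to a neighbour.\<close>

lemma relpow_step_subdivisionD:
  assumes "simple_graph \<Sigma>" "(Inl x, Inl y) \<in> step (subdivision \<Sigma>) ^^ n"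
  shows "\<exists>k. 2 * k \<le> n \<and> (x, y) \<in> step \<Sigma> ^^ k"
  using assms(2)
proof (induction n arbitrary: y rule: less_induct)
  case (less n)
  show ?case
  proof (cases n)
    case 0
    then show ?thesis using less.prems by auto
  next
    case (Suc m)
    then obtain e where e: "(Inl x, e) \<in> step (subdivision \<Sigma>) ^^ m" "(e, Inl y) \<in> step (subdivision \<Sigma>)"
      using less.prems by auto
    then obtain f where f: "e = Inr f" "f \<in> edges \<Sigma>" "y \<in> f"
      by (cases e) (auto simp: step_subdivision)
    then obtain l where l: "m = Suc l"
      using e by (cases m) auto
    then obtain z where z: "(Inl x, z) \<in> step (subdivision \<Sigma>) ^^ l" "(z, Inr f) \<in> step (subdivision \<Sigma>)"
      using e f by auto
    then obtain w where w: "z = Inl w" "w \<in> f"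
      by (cases z) (auto simp: step_subdivision)
    obtain k where k: "2 * k \<le> l" "(x, w) \<in> step \<Sigma> ^^ k"
      using less.IH[of l w] z w l Suc by auto
    show ?thesis
    proof (cases "w = y")
      case True
      then show ?thesis using k l Suc by (intro exI[of _ k]) auto
    next
      case False
      obtain a b where ab: "f = {a, b}" "a \<in> verts \<Sigma>" "b \<in> verts \<Sigma>"
        using simple_graph_edgeE[OF assms(1) f(2)] by metis
      then have "f = {w, y}"
        using f(3) w(2) False by auto
      then have "(w, y) \<in> step \<Sigma>"
        using ab f(2) by (auto simp: step_def doubleton_eq_iff insert_commute)
      then show ?thesis
        using k l Suc by (intro exI[of _ "Suc k"]) auto
    qed
  qed
qed

lemma connected_subdivision:
  assumes "simple_graph \<Sigma>" "connected_graph \<Sigma>"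
  shows "connected_graph (subdivision \<Sigma>)"
proof -
  let ?S = "subdivision \<Sigma>"
  have V: "(Inl x, Inl y) \<in> (step ?S)\<^sup>*" if "x \<in> verts \<Sigma>" "y \<in> verts \<Sigma>" for x y
    using relpow_step_subdivision[OF hop_attained[OF assms(2) that]] by (rule relpow_imp_rtrancl)
  have near: "\<exists>x\<in>verts \<Sigma>. (Inl x, z) \<in> (step ?S)\<^sup>* \<and> (z, Inl x) \<in> (step ?S)\<^sup>*"
    if "z \<in> verts ?S" for z
  proof (cases z)
    case (Inl x)
    then show ?thesis using that by auto
  next
    case (Inr e)
    then have "e \<in> edges \<Sigma>" using that by simp
    then obtain u w where "e = {u, w}" "u \<in> verts \<Sigma>"
      using simple_graph_edgeE[OF assms(1)] by metis
    then show ?thesis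
      using Inr \<open>e \<in> edges \<Sigma>\<close> by (intro bexI[of _ u] conjI r_into_rtrancl) (auto simp: step_subdivision)
  qed
  have "(y, z) \<in> (step ?S)\<^sup>*" if "y \<in> verts ?S" "z \<in> verts ?S" for y z
    using near[OF that(1)] near[OF that(2)] V by (meson rtrancl_trans)
  moreover have "verts ?S \<noteq> {}"
    using assms(2) by (auto simp: connected_graph_def subdivision_def)
  ultimately show ?thesis
    by (auto simp: connected_graph_iff)
qed

lemma hop_subdivision_Inl_Inl:
  assumes "simple_graph \<Sigma>" "connected_graph \<Sigma>" "x \<in> verts \<Sigma>" "y \<in> verts \<Sigma>"
  shows "hop (subdivision \<Sigma>) (Inl x) (Inl y) = 2 * hop \<Sigma> x y"
proof (rule antisym)
  show "hop (subdivision \<Sigma>) (Inl x) (Inl y) \<le> 2 * hop \<Sigma> x y"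
    by (intro hop_le relpow_step_subdivision hop_attained assms)
  obtain k where "2 * k \<le> hop (subdivision \<Sigma>) (Inl x) (Inl y)" "(x, y) \<in> step \<Sigma> ^^ k"
    using relpow_step_subdivisionD[OF assms(1) hop_attained] connected_subdivision assms
    by (metis verts_subdivision(1))
  then show "2 * hop \<Sigma> x y \<le> hop (subdivision \<Sigma>) (Inl x) (Inl y)"
    using hop_le[of x y k \<Sigma>] by simp
qed

text \<open>A walk can enter an edge of \<open>\<Sigma>\<close> only through one of its ends.\<close>

lemma hop_subdivision_Inr:
  assumes "simple_graph \<Sigma>" "connected_graph \<Sigma>" "z \<in> verts (subdivision \<Sigma>)"
    and "{a, b} \<in> edges \<Sigma>" "z \<noteq> Inr {a, b}"
  shows "hop (subdivision \<Sigma>) z (Inr {a, b}) =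
    Suc (min (hop (subdivision \<Sigma>) z (Inl a)) (hop (subdivision \<Sigma>) z (Inl b)))"
proof (rule antisym)
  let ?S = "subdivision \<Sigma>"
  note S = connected_subdivision[OF assms(1,2)]
  note ab = simple_graph_edgeD[OF assms(1,4)]
  have "hop ?S z (Inr {a, b}) \<le> Suc (hop ?S z (Inl c))" if "c \<in> {a, b}" for c
    using hop_triangle[OF S assms(3), of "Inl c" "Inr {a, b}"]
      hop_step[of "Inl c" "Inr {a, b}" ?S] that ab assms(4)
    by (auto simp: step_subdivision)
  then show "hop ?S z (Inr {a, b}) \<le> Suc (min (hop ?S z (Inl a)) (hop ?S z (Inl b)))"
    by (auto simp: min_def)
  have at: "(z, Inr {a, b}) \<in> step ?S ^^ hop ?S z (Inr {a, b})"
    using assms by (intro hop_attained S) auto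
  obtain m where m: "hop ?S z (Inr {a, b}) = Suc m"
    using hop_eq_0_iff[OF S assms(3), of "Inr {a, b}"] assms(4,5)
    by (cases "hop ?S z (Inr {a, b})") auto
  with at obtain y where y: "(z, y) \<in> step ?S ^^ m" "(y, Inr {a, b}) \<in> step ?S"
    by auto
  then have "y = Inl a \<or> y = Inl b"
    by (cases y) (auto simp: step_subdivision)
  then show "Suc (min (hop ?S z (Inl a)) (hop ?S z (Inl b))) \<le> hop ?S z (Inr {a, b})"
    using hop_le[OF y(1)] m by auto
qed

lemma hop_subdivision_Inl_Inr:
  assumes "simple_graph \<Sigma>" "connected_graph \<Sigma>" "x \<in> verts \<Sigma>" "{a, b} \<in> edges \<Sigma>"
  shows "hop (subdivision \<Sigma>) (Inl x) (Inr {a, b}) = Suc (2 * min (hop \<Sigma> x a) (hop \<Sigma> x b))"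
  using hop_subdivision_Inr[OF assms(1,2) _ assms(4), of "Inl x"] assms
    simple_graph_edgeD[OF assms(1,4)]
  by (simp add: hop_subdivision_Inl_Inl)

lemma hop_subdivision_Inr_Inr:
  assumes "simple_graph \<Sigma>" "connected_graph \<Sigma>" "{a, b} \<in> edges \<Sigma>" "{u, w} \<in> edges \<Sigma>"
    and "{a, b} \<noteq> {u, w}"
  shows "hop (subdivision \<Sigma>) (Inr {a, b}) (Inr {u, w}) =
    2 * min (min (hop \<Sigma> a u) (hop \<Sigma> b u)) (min (hop \<Sigma> a w) (hop \<Sigma> b w)) + 2"
  using hop_subdivision_Inr[OF assms(1,2) _ assms(4), of "Inr {a, b}"] assms
    simple_graph_edgeD[OF assms(1,3)] simple_graph_edgeD[OF assms(1,4)]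
    hop_sym[of "subdivision \<Sigma>" "Inr {a, b}" "Inl _"]
  by (simp add: hop_subdivision_Inl_Inr hop_sym[of \<Sigma> u] hop_sym[of \<Sigma> w])

section \<open>Arcs from geodesics of the subdivision graph\<close>

text \<open>A geodesic of the subdivision graph may start in a vertex or in an edge of \<open>\<Sigma>\<close>; the flag tells
  which of the two to read off the underlying arc. The end of the geodesic is read off the
  reversed arc in the same way.\<close>

definition arc_start :: "bool \<Rightarrow> 'a list \<Rightarrow> 'a + 'a set" where
  "arc_start b p = (if b then Inl (p ! 0) else Inr {p ! 0, p ! 1})"

text \<open>The arc follows a geodesic from \<open>x\<close> to the nearer end of \<open>e\<close> and then traverses \<open>e\<close>. It does
  not turn back there, because the other end of \<open>e\<close> is at least as far from \<open>x\<close>.\<close>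

lemma geodesic_subdivision_vertex_edge:
  assumes "simple_graph \<Sigma>" "connected_graph \<Sigma>" "x \<in> verts \<Sigma>" "e \<in> edges \<Sigma>"
  obtains n p where "hop (subdivision \<Sigma>) (Inl x) (Inr e) = Suc (2 * n)"
    and "p \<in> arcs \<Sigma> (Suc n)" "Inl x = arc_start True p" "Inr e = arc_start False (rev p)"
proof -
  obtain a b where ab: "e = {a, b}" "a \<in> verts \<Sigma>" "b \<in> verts \<Sigma>" "hop \<Sigma> x a \<le> hop \<Sigma> x b"
    by (metis simple_graph_edgeE[OF assms(1,4)] insert_commute nle_le)
  define n where "n = hop \<Sigma> x a"
  obtain p where p: "p \<in> arcs \<Sigma> n" "p ! 0 = x" "p ! n = a"
    "\<And>k. k \<le> n \<Longrightarrow> hop \<Sigma> x (p ! k) = k"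
    using geodesic_arc_exists[OF assms(2,3) ab(2)] unfolding n_def by metis
  have len: "length p = Suc n"
    using p(1) by (simp add: arcs_iff)
  have "b \<noteq> p ! (n - 1)" if "n > 0"
    using p(4)[of "n - 1"] that ab(4) by (auto simp: n_def)
  then have "p @ [b] \<in> arcs \<Sigma> (Suc n)"
    using p ab assms(4) by (intro arcs_snoc) auto
  moreover have "Inl x = arc_start True (p @ [b])" "Inr e = arc_start False (rev (p @ [b]))"
    using len p ab by (auto simp: arc_start_def nth_append rev_nth)
  moreover have "hop (subdivision \<Sigma>) (Inl x) (Inr e) = Suc (2 * n)"
    using hop_subdivision_Inl_Inr[OF assms(1-3), of a b] ab assms(4) by (simp add: n_def)
  ultimately show thesis
    using that by blast
qed

text \<open>The arc traverses \<open>e\<close>, follows a geodesic between the closest ends of the two edges, and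
  traverses \<open>f\<close>; as these ends are closest, it does not turn back at either of them.\<close>

lemma geodesic_subdivision_edge_edge:
  assumes "simple_graph \<Sigma>" "connected_graph \<Sigma>" "e \<in> edges \<Sigma>" "f \<in> edges \<Sigma>" "e \<noteq> f"
  obtains n p where "hop (subdivision \<Sigma>) (Inr e) (Inr f) = 2 * n + 2"
    and "p \<in> arcs \<Sigma> (n + 2)" "Inr e = arc_start False p" "Inr f = arc_start False (rev p)"
proof -
  obtain u w where "u \<in> e" "w \<in> f"
    by (rule simple_graph_edgeE[OF assms(1,3)], rule simple_graph_edgeE[OF assms(1,4)]) blast
  then obtain ab where "ab \<in> e \<times> f"
    and "\<forall>cd. cd \<in> e \<times> f \<longrightarrow> hop \<Sigma> (fst ab) (snd ab) \<le> hop \<Sigma> (fst cd) (snd cd)"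
    using ex_has_least_nat[of "\<lambda>cd. cd \<in> e \<times> f" "(u, w)" "\<lambda>cd. hop \<Sigma> (fst cd) (snd cd)"] by blast
  then obtain a b where ab: "a \<in> e" "b \<in> f"
    and least: "\<And>c d. c \<in> e \<Longrightarrow> d \<in> f \<Longrightarrow> hop \<Sigma> a b \<le> hop \<Sigma> c d"
    by (cases ab) auto
  obtain a' where a': "e = {a', a}"
    using simple_graph_edge_otherE[OF assms(1,3) ab(1)] insert_commute by metis
  obtain b' where b': "f = {b, b'}"
    using simple_graph_edge_otherE[OF assms(1,4) ab(2)] by metis
  note V = simple_graph_edgeD[OF assms(1,3)[unfolded a']] simple_graph_edgeD[OF assms(1,4)[unfolded b']]
  define n where "n = hop \<Sigma> a b"
  obtain p where p: "p \<in> arcs \<Sigma> n" "p ! 0 = a" "p ! n = b"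
    "\<And>k. k \<le> n \<Longrightarrow> hop \<Sigma> a (p ! k) = k" "\<And>k. k \<le> n \<Longrightarrow> hop \<Sigma> (p ! k) b = n - k"
    using geodesic_arc_exists[OF assms(2) V(2) V(4)] unfolding n_def by metis
  have len: "length p = Suc n"
    using p(1) by (simp add: arcs_iff)
  have "b' \<noteq> p ! (n - 1)" if "n > 0"
    using p(4)[of "n - 1"] that least[of a b'] ab b' by (auto simp: n_def)
  then have q: "p @ [b'] \<in> arcs \<Sigma> (Suc n)"
    using p V b' assms(4) by (intro arcs_snoc) auto
  \<comment> \<open>If the edges share a vertex, their other ends differ because the edges do.\<close>
  have "a' \<noteq> (p @ [b']) ! 1"
  proof (cases "n = 0")
    case True
    then have "a = b" "(p @ [b']) ! 1 = b'"
      using p len by (auto simp: nth_append)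
    then show ?thesis
      using a' b' assms(5) by auto
  next
    case False
    then show ?thesis
      using p(5)[of 1] least[of a' b] a' ab len by (auto simp: n_def nth_append)
  qed
  then have "a' # p @ [b'] \<in> arcs \<Sigma> (Suc (Suc n))"
    using q V a' assms(3) p len by (intro arcs_Cons) (auto simp: nth_append)
  moreover have "Inr e = arc_start False (a' # p @ [b'])"
    "Inr f = arc_start False (rev (a' # p @ [b']))"
    using len p a' b' by (auto simp: arc_start_def nth_append rev_nth insert_commute)
  moreover have "hop (subdivision \<Sigma>) (Inr e) (Inr f) = 2 * n + 2"
  proof -
    have "hop \<Sigma> a b \<le> hop \<Sigma> a' b" "hop \<Sigma> a b \<le> hop \<Sigma> a' b'" "hop \<Sigma> a b \<le> hop \<Sigma> a b'"
      using least a' b' by auto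
    then show ?thesis
      using hop_subdivision_Inr_Inr[OF assms(1,2), of a' a b b'] assms a' b' by (simp add: n_def)
  qed
  ultimately show thesis
    using that[of n "a' # p @ [b']"] by simp
qed

text \<open>A geodesic of the subdivision graph runs along an arc of \<open>\<Sigma>\<close>, which overshoots it at each
  end where the geodesic ends in an edge. The length of the arc depends only on the type of the
  first vertex and the length of the geodesic, so one group element can carry the arc of one
  geodesic to that of another.\<close>

lemma geodesic_subdivision_arc:
  assumes "simple_graph \<Sigma>" "connected_graph \<Sigma>"
    and "v \<in> verts (subdivision \<Sigma>)" "z \<in> verts (subdivision \<Sigma>)"
    and "hop (subdivision \<Sigma>) v z = i" "i > 0"
  shows "isl z = (isl v = even i) \<and>
    (\<exists>p \<in> arcs \<Sigma> (if isl v then (i + 1) div 2 else i div 2 + 1).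
      v = arc_start (isl v) p \<and> z = arc_start (isl z) (rev p))"
proof (cases v; cases z)
  fix x y assume xy: "v = Inl x" "z = Inl y"
  then have V: "x \<in> verts \<Sigma>" "y \<in> verts \<Sigma>"
    using assms by auto
  then have i: "i = 2 * hop \<Sigma> x y"
    using hop_subdivision_Inl_Inl[OF assms(1,2)] assms(5) xy by simp
  obtain p where "p \<in> arcs \<Sigma> (hop \<Sigma> x y)" "p ! 0 = x" "p ! hop \<Sigma> x y = y"
    by (rule geodesic_arc_exists[OF assms(2) V])
  then show ?thesis
    using i xy by (auto simp: arc_start_def rev_nth arcs_iff intro!: bexI[of _ p])
next
  fix x e assume xe: "v = Inl x" "z = Inr e"
  then have V: "x \<in> verts \<Sigma>" "e \<in> edges \<Sigma>"
    using assms by auto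
  obtain n p where np: "hop (subdivision \<Sigma>) v z = Suc (2 * n)" "p \<in> arcs \<Sigma> (Suc n)"
    "v = arc_start True p" "z = arc_start False (rev p)"
    using geodesic_subdivision_vertex_edge[OF assms(1,2) V] unfolding xe by blast
  moreover have "isl v" "\<not> isl z" "i = Suc (2 * n)"
    using xe np(1) assms(5) by auto
  ultimately show ?thesis
    by auto
next
  fix x e assume xe: "v = Inr e" "z = Inl x"
  then have V: "x \<in> verts \<Sigma>" "e \<in> edges \<Sigma>"
    using assms by auto
  obtain n p where np: "hop (subdivision \<Sigma>) z v = Suc (2 * n)" "p \<in> arcs \<Sigma> (Suc n)"
    "z = arc_start True p" "v = arc_start False (rev p)"
    using geodesic_subdivision_vertex_edge[OF assms(1,2) V] unfolding xe by blast
  moreover have "\<not> isl v" "isl z" "i = Suc (2 * n)"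
    using xe np(1) assms(5) hop_sym[of "subdivision \<Sigma>" v z] by auto
  ultimately show ?thesis
    using arcs_rev[OF np(2)] by (auto intro!: bexI[of _ "rev p"])
next
  fix e f assume ef: "v = Inr e" "z = Inr f"
  then have E: "e \<in> edges \<Sigma>" "f \<in> edges \<Sigma>" "e \<noteq> f"
    using assms by auto
  obtain n p where np: "hop (subdivision \<Sigma>) v z = 2 * n + 2" "p \<in> arcs \<Sigma> (n + 2)"
    "v = arc_start False p" "z = arc_start False (rev p)"
    using geodesic_subdivision_edge_edge[OF assms(1,2) E] unfolding ef by blast
  moreover have "\<not> isl v" "\<not> isl z" "i = 2 * n + 2"
    using ef np(1) assms(5) by auto
  ultimately show ?thesis
    by auto
qed


section \<open>Groups of automorphisms\<close>

locale graph_automorphism_group =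
  fixes \<Sigma> :: "'a graph" and G :: "('a \<Rightarrow> 'a) set"
  assumes simple: "simple_graph \<Sigma>"
    and connected: "connected_graph \<Sigma>"
    and subgroup: "subgroup G (Aut \<Sigma>)"
begin

abbreviation "S \<equiv> subdivision \<Sigma>"
abbreviation "act \<equiv> subdivision_act \<Sigma>"
abbreviation "arc_trans n \<equiv> transitive_on G map (arcs \<Sigma> n)"

lemma G_Bij: "g \<in> G \<Longrightarrow> g \<in> Bij (verts \<Sigma>)"
  using subgroup.subset[OF subgroup] by (auto simp: Aut_def)

lemma G_edge:
  "g \<in> G \<Longrightarrow> u \<in> verts \<Sigma> \<Longrightarrow> v \<in> verts \<Sigma> \<Longrightarrow> {g u, g v} \<in> edges \<Sigma> \<longleftrightarrow> {u, v} \<in> edges \<Sigma>"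
  using subgroup.subset[OF subgroup] by (auto simp: Aut_def)

lemma G_bij_betw: "g \<in> G \<Longrightarrow> bij_betw g (verts \<Sigma>) (verts \<Sigma>)"
  using G_Bij by (auto simp: Bij_def)

lemma G_mem: "g \<in> G \<Longrightarrow> x \<in> verts \<Sigma> \<Longrightarrow> g x \<in> verts \<Sigma>"
  using G_bij_betw bij_betwE by metis

lemma G_eq_iff:
  "g \<in> G \<Longrightarrow> x \<in> verts \<Sigma> \<Longrightarrow> y \<in> verts \<Sigma> \<Longrightarrow> g x = g y \<longleftrightarrow> x = y"
  using G_bij_betw[of g] inj_on_eq_iff[of g "verts \<Sigma>"] by (auto simp: bij_betw_def)

text \<open>Elements of \<open>Aut \<Sigma>\<close> are multiplied by composing them on the vertices only, which is why
  products and inverses are given pointwise there.\<close>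

lemma G_compose:
  assumes "g \<in> G" "h \<in> G"
  obtains k where "k \<in> G" "\<And>x. x \<in> verts \<Sigma> \<Longrightarrow> k x = g (h x)"
proof
  show "g \<otimes>\<^bsub>Aut \<Sigma>\<^esub> h \<in> G"
    using subgroup.m_closed[OF subgroup assms] .
  show "(g \<otimes>\<^bsub>Aut \<Sigma>\<^esub> h) x = g (h x)" if "x \<in> verts \<Sigma>" for x
    using that assms G_Bij by (simp add: Aut_def BijGroup_def compose_def)
qed

lemma G_inverse:
  assumes "g \<in> G"
  obtains k where "k \<in> G" "\<And>x. x \<in> verts \<Sigma> \<Longrightarrow> k (g x) = x"
proof -
  interpret A: group "Aut \<Sigma>" by (rule group_Aut)
  obtain k where k: "k \<in> G" "k \<otimes>\<^bsub>Aut \<Sigma>\<^esub> g = \<one>\<^bsub>Aut \<Sigma>\<^esub>"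
    using subgroup.m_inv_closed[OF subgroup assms] subgroup.mem_carrier[OF subgroup assms] A.l_inv
    by blast
  then have eq: "compose (verts \<Sigma>) k g = (\<lambda>x\<in>verts \<Sigma>. x)"
    using G_Bij[OF k(1)] G_Bij[OF assms] by (simp add: Aut_def BijGroup_def)
  have "k (g x) = x" if "x \<in> verts \<Sigma>" for x
    using fun_cong[OF eq, of x] that by (simp add: compose_def)
  then show thesis
    using that k(1) by blast
qed

lemma map_arc:
  assumes "g \<in> G" "p \<in> arcs \<Sigma> n"
  shows "map g p \<in> arcs \<Sigma> n"
  unfolding arcs_iff
proof (intro conjI allI impI)
  have len: "length p = Suc n" and V: "\<And>j. j \<le> n \<Longrightarrow> p ! j \<in> verts \<Sigma>"
    using assms(2) arcs_nth_mem by (auto simp: arcs_iff)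
  show "length (map g p) = Suc n" "set (map g p) \<subseteq> verts \<Sigma>"
    using assms(2) G_mem[OF assms(1)] by (auto simp: arcs_iff)
  fix j
  show "{map g p ! j, map g p ! Suc j} \<in> edges \<Sigma>" if "j < n"
    using that len V G_edge[OF assms(1), of "p ! j" "p ! Suc j"] assms(2) by (simp add: arcs_iff)
  show "map g p ! j \<noteq> map g p ! (j + 2)" if "j + 2 \<le> n"
    using that len V G_eq_iff[OF assms(1), of "p ! j" "p ! (j + 2)"] assms(2) by (simp add: arcs_iff)
qed

lemma hop_act:
  assumes "g \<in> G" "u \<in> verts \<Sigma>" "v \<in> verts \<Sigma>"
  shows "hop \<Sigma> (g u) (g v) = hop \<Sigma> u v"
proof -
  have le: "hop \<Sigma> (h x) (h y) \<le> hop \<Sigma> x y" if h: "h \<in> G" and xy: "x \<in> verts \<Sigma>" "y \<in> verts \<Sigma>" for h x y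
  proof -
    obtain p where p: "p \<in> arcs \<Sigma> (hop \<Sigma> x y)" "p ! 0 = x" "p ! hop \<Sigma> x y = y"
      by (rule geodesic_arc_exists[OF connected xy])
    then show ?thesis
      using hop_arc_le[OF map_arc[OF h p(1)], of 0 "hop \<Sigma> x y"] by (simp add: arcs_iff)
  qed
  obtain k where "k \<in> G" "\<And>x. x \<in> verts \<Sigma> \<Longrightarrow> k (g x) = x"
    using G_inverse[OF assms(1)] by blast
  then show ?thesis
    using le[of k "g u" "g v"] le[of g u v] assms G_mem[OF assms(1)] by (intro antisym) auto
qed

lemma act_Inl [simp]: "x \<in> verts \<Sigma> \<Longrightarrow> act g (Inl x) = Inl (g x)"
  by (simp add: subdivision_act_def)

lemma act_Inr [simp]: "e \<in> edges \<Sigma> \<Longrightarrow> act g (Inr e) = Inr (g ` e)"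
  by (simp add: subdivision_act_def)

lemma act_arc_start:
  assumes "p \<in> arcs \<Sigma> n" "n > 0"
  shows "act g (arc_start b p) = arc_start b (map g p)"
  using assms arcs_nth_mem[OF assms(1), of 0]
  by (cases b) (auto simp: arc_start_def arcs_iff)

lemma transitive_on_arcsI:
  assumes "c \<in> arcs \<Sigma> n" "\<And>a. a \<in> arcs \<Sigma> n \<Longrightarrow> \<exists>g\<in>G. map g c = a"
  shows "arc_trans n"
  unfolding transitive_on_def
proof (intro ballI)
  fix a b assume a: "a \<in> arcs \<Sigma> n" and b: "b \<in> arcs \<Sigma> n"
  obtain g where g: "g \<in> G" "map g c = a"
    using assms(2)[OF a] by blast
  obtain h where h: "h \<in> G" "map h c = b"
    using assms(2)[OF b] by blast
  obtain g' where g': "g' \<in> G" "\<And>x. x \<in> verts \<Sigma> \<Longrightarrow> g' (g x) = x"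
    using G_inverse[OF g(1)] by blast
  obtain k where k: "k \<in> G" "\<And>x. x \<in> verts \<Sigma> \<Longrightarrow> k x = h (g' x)"
    using G_compose[OF h(1) g'(1)] by blast
  have "map k a = b"
    using assms(1) g h g' k G_mem[OF g(1)] by (auto simp: arcs_iff subset_iff)
  then show "\<exists>g\<in>G. map g a = b"
    using k by blast
qed


section \<open>From arcs to distances\<close>

lemma sphere_transitive_if_arc_transitive:
  assumes trans: "\<And>k. 1 \<le> k \<Longrightarrow> k \<le> s div 2 + 1 \<Longrightarrow> arc_trans k"
    and v: "v \<in> verts S" and i: "1 \<le> i" "i \<le> s"
  shows "transitive_on {g \<in> G. act g v = v} act (sphere S i v)"
  unfolding transitive_on_def
proof (intro ballI)
  note S = connected_subdivision[OF simple connected]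
  fix y z assume "y \<in> sphere S i v" "z \<in> sphere S i v"
  then have yz: "y \<in> verts S" "hop S v y = i" "z \<in> verts S" "hop S v z = i"
    by (simp_all add: sphere_iff_hop[OF S v])
  define k where "k = (if isl v then (i + 1) div 2 else i div 2 + 1)"
  have k: "1 \<le> k" "k \<le> s div 2 + 1" and i0: "i > 0"
    using i by (auto simp: k_def)
  obtain p where p: "p \<in> arcs \<Sigma> k" "v = arc_start (isl v) p" "y = arc_start (isl y) (rev p)"
    using geodesic_subdivision_arc[OF simple connected v yz(1,2) i0] unfolding k_def by blast
  obtain q where q: "q \<in> arcs \<Sigma> k" "v = arc_start (isl v) q" "z = arc_start (isl z) (rev q)"
    using geodesic_subdivision_arc[OF simple connected v yz(3,4) i0] unfolding k_def by blast
  have same_type: "isl y = isl z"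
    using geodesic_subdivision_arc[OF simple connected v] yz i0 by simp
  obtain g where g: "g \<in> G" "map g p = q"
    using trans[OF k] p(1) q(1) by (auto simp: transitive_on_def)
  have "act g v = v"
    using act_arc_start[OF p(1), of g "isl v"] k p(2) q(2) g(2) by simp
  moreover have "map g (rev p) = rev q"
    using g(2) by (metis rev_map)
  then have "act g y = z"
    using act_arc_start[OF arcs_rev[OF p(1)], of g "isl y"] k p(3) q(3) same_type by simp
  ultimately show "\<exists>g\<in>{g \<in> G. act g v = v}. act g y = z"
    using g by blast
qed


section \<open>From distances to arcs\<close>

text \<open>The \<open>1\<close>-arcs that a fixed one can be carried to are closed under reversal and under change of
  the second vertex, so by connectedness they are all \<open>1\<close>-arcs.\<close>

lemma arc_transitive_1:
  assumes trans: "\<And>v. v \<in> verts S \<Longrightarrow> transitive_on {g \<in> G. act g v = v} act (sphere S 1 v)"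
  shows "arc_trans 1"
proof (cases "arcs \<Sigma> 1 = {}")
  case False
  note S = connected_subdivision[OF simple connected]
  have arc1: "p \<in> arcs \<Sigma> 1 \<longleftrightarrow> (\<exists>u v. p = [u, v] \<and> (u, v) \<in> step \<Sigma>)" for p
    by (auto simp: arcs_iff step_def length_Suc_conv)
  obtain c where c: "c \<in> arcs \<Sigma> 1"
    using False by blast
  then obtain c0 c1 where c01: "c = [c0, c1]" "(c0, c1) \<in> step \<Sigma>"
    using arc1 by blast
  define reach where "reach u v \<longleftrightarrow> (\<exists>g\<in>G. g c0 = u \<and> g c1 = v)" for u v
  have V: "c0 \<in> verts \<Sigma>" "c1 \<in> verts \<Sigma>"
    using c01 by (auto simp: step_def)
  have extend: "reach (h u) (h v)" if reach: "reach u v" and h: "h \<in> G" for u v h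
  proof -
    from reach obtain g where g: "g \<in> G" "g c0 = u" "g c1 = v"
      by (auto simp: reach_def)
    obtain k where "k \<in> G" "\<And>x. x \<in> verts \<Sigma> \<Longrightarrow> k x = h (g x)"
      using G_compose[OF h g(1)] by blast
    then show ?thesis
      using g V by (auto simp: reach_def)
  qed
  \<comment> \<open>The stabiliser of a vertex is transitive on the edges through it.\<close>
  have turn: "\<exists>h\<in>G. h u = u \<and> h v = w" if uv: "(u, v) \<in> step \<Sigma>" and uw: "(u, w) \<in> step \<Sigma>" for u v w
  proof -
    have u: "u \<in> verts \<Sigma>" and v: "v \<in> verts \<Sigma>" and e: "{u, v} \<in> edges \<Sigma>" "{u, w} \<in> edges \<Sigma>"
      using uv uw by (auto simp: step_def)
    have "Inr {u, v} \<in> sphere S 1 (Inl u)" "Inr {u, w} \<in> sphere S 1 (Inl u)"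
      using hop_subdivision_Inl_Inr[OF simple connected u e(1)]
        hop_subdivision_Inl_Inr[OF simple connected u e(2)] u e
      by (simp_all add: sphere_iff_hop[OF S])
    then obtain h where h: "h \<in> G" "act h (Inl u) = Inl u" "act h (Inr {u, v}) = Inr {u, w}"
      using trans[of "Inl u"] u unfolding transitive_on_def verts_subdivision by blast
    then have "h u = u" "{h u, h v} = {u, w}"
      using u e by simp_all
    then show ?thesis
      using h(1) by (auto simp: doubleton_eq_iff)
  qed
  \<comment> \<open>The stabiliser of an edge interchanges its ends.\<close>
  have flip: "\<exists>h\<in>G. h u = v \<and> h v = u" if uv: "(u, v) \<in> step \<Sigma>" for u v
  proof -
    have uV: "u \<in> verts \<Sigma>" "v \<in> verts \<Sigma>" and e: "{u, v} \<in> edges \<Sigma>"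
      using uv by (auto simp: step_def)
    have ne: "u \<noteq> v"
      using simple_graph_edgeD[OF simple e] by blast
    have "Inl u \<in> sphere S 1 (Inr {u, v})" "Inl v \<in> sphere S 1 (Inr {u, v})"
      using hop_subdivision_Inl_Inr[OF simple connected uV(1) e]
        hop_subdivision_Inl_Inr[OF simple connected uV(2) e] uV e hop_sym[of S "Inr {u, v}"]
      by (simp_all add: sphere_iff_hop[OF S])
    then obtain h where h: "h \<in> G" "act h (Inr {u, v}) = Inr {u, v}" "act h (Inl u) = Inl v"
      using trans[of "Inr {u, v}"] e unfolding transitive_on_def verts_subdivision by blast
    then have "h u = v" "{h u, h v} = {u, v}"
      using uV e by simp_all
    then show ?thesis
      using h(1) ne by (auto simp: doubleton_eq_iff)
  qed
  have all: "\<forall>y. (u, y) \<in> step \<Sigma> \<longrightarrow> reach u y" if "(c0, u) \<in> (step \<Sigma>)\<^sup>*" for u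
    using that
  proof (induction rule: rtrancl_induct)
    case base
    have "\<exists>h\<in>G. h c0 = c0 \<and> h c1 = y" if "(c0, y) \<in> step \<Sigma>" for y
      using turn c01 that by blast
    then show ?case
      by (auto simp: reach_def)
  next
    case (step u w)
    show ?case
    proof (intro allI impI)
      fix y assume wy: "(w, y) \<in> step \<Sigma>"
      have "reach w u"
        using step flip[of u w] extend by metis
      then show "reach w y"
        using turn[OF step_sym wy, of u] step extend by metis
    qed
  qed
  show ?thesis
  proof (rule transitive_on_arcsI[OF c])
    fix a assume "a \<in> arcs \<Sigma> 1"
    then obtain u w where "a = [u, w]" "(u, w) \<in> step \<Sigma>"
      using arc1 by blast
    moreover from this have "reach u w"
      using all connected V by (auto simp: connected_graph_iff step_def)
    ultimately show "\<exists>g\<in>G. map g c = a"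
      using c01 by (auto simp: reach_def)
  qed
qed (simp add: transitive_on_def)

text \<open>Automorphisms preserve distances, so a single geodesic forces all arcs of its length to be
  geodesics.\<close>

lemma arcs_geodesic_if_transitive:
  assumes "arc_trans n" "c \<in> arcs \<Sigma> n" "hop \<Sigma> (c ! 0) (c ! n) = n" "p \<in> arcs \<Sigma> n"
  shows "hop \<Sigma> (p ! 0) (p ! n) = n"
proof -
  obtain g where g: "g \<in> G" "map g c = p"
    using assms by (auto simp: transitive_on_def)
  have "length c = Suc n"
    using assms(2) by (simp add: arcs_iff)
  then have "p ! 0 = g (c ! 0)" "p ! n = g (c ! n)"
    using g(2) by auto
  then show ?thesis
    using hop_act[OF g(1)] arcs_nth_mem[OF assms(2)] assms(3) by simp
qed

text \<open>Let \<open>c\<close> be a geodesic and \<open>a\<close> any arc of the same length \<open>i + 1\<close>; after moving \<open>c\<close> by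
  the group to some \<open>b\<close>, the two differ at most in their last vertices. The first edge \<open>e\<close> and
  the last edges of \<open>a\<close> and \<open>b\<close> have distance \<open>2 i\<close> in the subdivision graph, so some \<open>h\<close> fixing
  \<open>e\<close> carries the last edge of \<open>b\<close> to that of \<open>a\<close>. The inner ends of the two edges are at distance
  \<open>i - 1\<close>. If \<open>h\<close> interchanged ends at one side only, it would send this pair to one at distance
  \<open>i\<close>; if it did so at both sides, the outer ends of \<open>b\<close>, at distance \<open>i + 1\<close>, would go to the
  inner ends of \<open>a\<close>. Hence \<open>h\<close> sends the ends of \<open>b\<close> to those of \<open>a\<close>, and what lies in between is
  an arc of length \<open>i - 1\<close>, which is determined by its ends.\<close>

lemma arc_transitive_Suc:
  assumes i: "i > 0"
    and trans_i: "arc_trans i"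
    and geo: "\<And>k p. k \<le> i \<Longrightarrow> p \<in> arcs \<Sigma> k \<Longrightarrow> hop \<Sigma> (p ! 0) (p ! k) = k"
    and c: "c \<in> arcs \<Sigma> (Suc i)" "hop \<Sigma> (c ! 0) (c ! Suc i) = Suc i"
    and trans: "\<And>v. v \<in> verts S \<Longrightarrow> transitive_on {g \<in> G. act g v = v} act (sphere S (2 * i) v)"
  shows "arc_trans (Suc i)"
proof (rule transitive_on_arcsI[OF c(1)])
  note S = connected_subdivision[OF simple connected]
  fix a assume a: "a \<in> arcs \<Sigma> (Suc i)"
  have geo_segment: "hop \<Sigma> (p ! j) (p ! k) = k - j"
    if "p \<in> arcs \<Sigma> (Suc i)" "j \<le> k" "k \<le> Suc i" "k - j \<le> i" for p j k
    using geo[OF that(4) arcs_segment[OF that(1), of j "k - j"]] that by (simp add: arcs_iff)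
  have init: "take (Suc i) p \<in> arcs \<Sigma> i" if "p \<in> arcs \<Sigma> (Suc i)" for p
    using arcs_segment[OF that, of 0 i] by simp
  obtain g where g: "g \<in> G" "map g (take (Suc i) c) = take (Suc i) a"
    using trans_i init[OF c(1)] init[OF a] by (auto simp: transitive_on_def)
  define b where "b = map g c"
  have b: "b \<in> arcs \<Sigma> (Suc i)"
    using map_arc[OF g(1) c(1)] by (simp add: b_def)
  have len: "length a = Suc (Suc i)" "length b = Suc (Suc i)" "length c = Suc (Suc i)"
    using a b c by (auto simp: arcs_iff)
  have agree: "b ! j = a ! j" if "j \<le> i" for j
  proof -
    have "take (Suc i) b = take (Suc i) a"
      using g(2) by (simp add: b_def take_map)
    then show ?thesis
      using that by (metis le_imp_less_Suc nth_take)
  qed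
  have b_far: "hop \<Sigma> (a ! 0) (b ! Suc i) = Suc i"
    using hop_act[OF g(1), of "c ! 0" "c ! Suc i"] c arcs_nth_mem[OF c(1)] len agree[of 0]
    by (simp add: b_def)
  let ?e = "{a ! 0, a ! 1}" and ?fa = "{a ! i, a ! Suc i}" and ?fb = "{a ! i, b ! Suc i}"
  have aV: "a ! j \<in> verts \<Sigma>" and bV: "b ! j \<in> verts \<Sigma>" if "j \<le> Suc i" for j
    using arcs_nth_mem[OF a that] arcs_nth_mem[OF b that] .
  have E: "?e \<in> edges \<Sigma>" "?fa \<in> edges \<Sigma>" "?fb \<in> edges \<Sigma>"
    using a b agree[of i] by (auto simp: arcs_iff)
  have d: "hop \<Sigma> (a ! 0) (a ! i) = i" "hop \<Sigma> (a ! 1) (a ! i) = i - 1"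
    "hop \<Sigma> (a ! 1) (a ! Suc i) = i" "hop \<Sigma> (a ! 1) (b ! Suc i) = i"
    using geo_segment[OF a, of 0 i] geo_segment[OF a, of 1 i] geo_segment[OF a, of 1 "Suc i"]
      geo_segment[OF b, of 1 "Suc i"] agree[of 1] i by auto
  have a_far: "hop \<Sigma> (a ! 0) (a ! Suc i) \<ge> i - 1"
    using hop_triangle[OF connected, of "a ! 0" "a ! Suc i" "a ! i"] d(1) aV
      hop_arc_le[OF a, of i "Suc i"] by (simp add: hop_sym[of \<Sigma> "a ! Suc i"])
  have ne: "a ! 0 \<noteq> a ! 1" "a ! i \<noteq> a ! Suc i" "a ! i \<noteq> b ! Suc i"
    using simple_graph_edgeD(3)[OF simple] E by auto
  have ne_a: "?e \<noteq> ?fa"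
  proof
    assume "?e = ?fa"
    then have "a ! 0 = a ! i \<or> a ! 1 = a ! i \<and> a ! 0 = a ! Suc i"
      by (auto simp: doubleton_eq_iff)
    then have "i = 1 \<and> a ! 0 = a ! Suc i"
      using d i by auto
    then show False
      using a by (auto simp: arcs_iff numeral_2_eq_2)
  qed
  have ne_b: "?e \<noteq> ?fb"
  proof
    assume "?e = ?fb"
    then have "a ! 0 = a ! i \<or> a ! 0 = b ! Suc i"
      by (auto simp: doubleton_eq_iff)
    then show False
      using d b_far i by auto
  qed
  have "Inr ?fa \<in> sphere S (2 * i) (Inr ?e)" "Inr ?fb \<in> sphere S (2 * i) (Inr ?e)"
    using hop_subdivision_Inr_Inr[OF simple connected E(1) E(2) ne_a]
      hop_subdivision_Inr_Inr[OF simple connected E(1) E(3) ne_b] d a_far b_far i E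
    by (simp_all add: sphere_iff_hop[OF S])
  then obtain h where h: "h \<in> G" "act h (Inr ?e) = Inr ?e" "act h (Inr ?fb) = Inr ?fa"
    using trans[of "Inr ?e"] E unfolding transitive_on_def verts_subdivision by blast
  then have he: "{h (a ! 0), h (a ! 1)} = ?e" and hf: "{h (a ! i), h (b ! Suc i)} = ?fa"
    using E by simp_all
  have hd: "hop \<Sigma> (h (a ! 1)) (h (a ! i)) = i - 1"
    "hop \<Sigma> (h (a ! 0)) (h (b ! Suc i)) = Suc i"
    using d b_far hop_act[OF h(1)] aV bV i by auto
  have "h (a ! 0) = a ! 0 \<and> h (a ! 1) = a ! 1 \<and> h (a ! i) = a ! i \<and> h (b ! Suc i) = a ! Suc i"
    using he hf hd d i unfolding doubleton_eq_iff by auto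
  then have h_ends: "h (a ! 0) = a ! 0" "h (a ! 1) = a ! 1" "h (a ! i) = a ! i" "h (b ! Suc i) = a ! Suc i"
    by auto
  have mid: "take i (drop 1 p) \<in> arcs \<Sigma> (i - 1)" if "p \<in> arcs \<Sigma> (Suc i)" for p
    using arcs_segment[OF that, of 1 "i - 1"] i by simp
  have "take i (drop 1 (map h b)) = take i (drop 1 a)"
    using mid[OF map_arc[OF h(1) b]] mid[OF a] geo i len h_ends agree
    by (intro arcs_eq_if_geodesic[of "i - 1"]) auto
  have "map h b = a"
  proof (rule nth_equalityI)
    fix j assume "j < length (map h b)"
    then consider "j = 0" | "j = Suc i" | "1 \<le> j" "j \<le> i"
      using len by fastforce
    then show "map h b ! j = a ! j"
    proof cases
      case 3
      then have "take i (drop 1 (map h b)) ! (j - 1) = map h b ! j"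
        "take i (drop 1 a) ! (j - 1) = a ! j"
        using len by auto
      then show ?thesis
        using \<open>take i (drop 1 (map h b)) = take i (drop 1 a)\<close> by simp
    qed (use len h_ends agree in auto)
  qed (use len in simp)
  moreover obtain k where "k \<in> G" "\<And>x. x \<in> verts \<Sigma> \<Longrightarrow> k x = h (g x)"
    using G_compose[OF h(1) g(1)] by blast
  moreover from this have "map k c = map h b"
    using c(1) by (auto simp: b_def arcs_iff subset_iff)
  ultimately show "\<exists>g\<in>G. map g c = a"
    by metis
qed

lemma arc_transitive_if_sphere_transitive:
  assumes trans: "\<And>v i. v \<in> verts S \<Longrightarrow> 1 \<le> i \<Longrightarrow> i \<le> s \<Longrightarrow>
      transitive_on {g \<in> G. act g v = v} act (sphere S i v)"
    and s: "s > 0" and diam: "enat (s div 2 + 1) \<le> diam \<Sigma>"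
    and n: "1 \<le> n" "n \<le> s div 2 + 1"
  shows "arc_trans n"
  using n
proof (induction n rule: less_induct)
  case (less n)
  show ?case
  proof (cases "n = 1")
    case True
    then show ?thesis
      using arc_transitive_1 trans s by simp
  next
    case False
    then obtain i where i: "n = Suc i" "i > 0"
      using less.prems by (cases n) auto
    have geodesic: "\<exists>c\<in>arcs \<Sigma> k. hop \<Sigma> (c ! 0) (c ! k) = k" if "k \<le> n" for k
    proof -
      have "enat k \<le> diam \<Sigma>"
        using that less.prems diam order_trans[of "enat k" "enat (s div 2 + 1)"] by simp
      then obtain u w where uw: "u \<in> verts \<Sigma>" "w \<in> verts \<Sigma>" "hop \<Sigma> u w = k"
        by (rule geodesic_of_length_exists[OF connected])
      show ?thesis
        using geodesic_arc_exists[OF connected uw(1,2)] uw(3) by metis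
    qed
    have geo: "hop \<Sigma> (p ! 0) (p ! k) = k" if k: "k \<le> i" and p: "p \<in> arcs \<Sigma> k" for k p
    proof (cases "k = 0")
      case False
      then have "arc_trans k"
        using less.IH[of k] less.prems k i by simp
      moreover obtain b where "b \<in> arcs \<Sigma> k" "hop \<Sigma> (b ! 0) (b ! k) = k"
        using geodesic[of k] k i by auto
      ultimately show ?thesis
        using arcs_geodesic_if_transitive p by blast
    qed simp
    obtain c where "c \<in> arcs \<Sigma> (Suc i)" "hop \<Sigma> (c ! 0) (c ! Suc i) = Suc i"
      using geodesic i by blast
    moreover have "arc_trans i"
      using less.IH[of i] less.prems i by simp
    moreover have "1 \<le> 2 * i" "2 * i \<le> s"
      using i less.prems by auto
    ultimately show ?thesis
      unfolding i(1) using arc_transitive_Suc[OF i(2)] geo trans by blast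
  qed
qed

end


section \<open>The equivalence\<close>

theorem theorem1p2:
  fixes \<Sigma> :: "'a graph" and G :: "('a \<Rightarrow> 'a) set" and s :: nat
  assumes "simple_graph \<Sigma>" and "connected_graph \<Sigma>"
    and "subgroup G (Aut \<Sigma>)"
    and "s > 0" and "enat s \<le> 2 * diam \<Sigma> - 1"
  shows "enat s < diam (subdivision \<Sigma>) \<and>
    (locally_distance_transitive (Aut \<Sigma>\<lparr>carrier := G\<rparr>) (subdivision_act \<Sigma>) (subdivision \<Sigma>) s
     \<longleftrightarrow> arc_transitive (Aut \<Sigma>\<lparr>carrier := G\<rparr>) (\<lambda>g. g) \<Sigma> (nat \<lceil>(real s + 1) / 2\<rceil>))"
proof -
  interpret graph_automorphism_group \<Sigma> G
    by (rule graph_automorphism_group.intro) (fact assms)+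
  note S = connected_subdivision[OF simple connected]
  define t where "t = s div 2 + 1"
  have t: "nat \<lceil>(real s + 1) / 2\<rceil> = t"
  proof -
    have "\<lceil>(real s + 1) / 2\<rceil> = int t"
      unfolding ceiling_eq_iff t_def by (cases "even s") (auto elim!: evenE oddE)
    then show ?thesis by simp
  qed
  have diam: "enat t \<le> diam \<Sigma>"
  proof (cases "diam \<Sigma>")
    case (enat d)
    then have "2 * diam \<Sigma> - 1 = enat (2 * d - 1)"
      by (simp add: numeral_eq_enat one_enat_def)
    then show ?thesis
      using assms(4,5) enat by (simp add: t_def)
  qed simp
  obtain u w where uw: "u \<in> verts \<Sigma>" "w \<in> verts \<Sigma>" "hop \<Sigma> u w = t"
    by (rule geodesic_of_length_exists[OF connected diam])
  have far: "hop S (Inl u) (Inl w) = 2 * t"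
    using hop_subdivision_Inl_Inl[OF simple connected uw(1,2)] uw(3) by simp
  have "Inl u \<in> verts S" "Inl w \<in> verts S"
    using uw(1,2) by simp_all
  then have "gdist S (Inl u) (Inl w) \<le> diam S"
    unfolding diam_def by (intro Sup_upper) blast
  then have "enat (2 * t) \<le> diam S"
    using uw(1,2) far by (simp add: gdist_eq_hop[OF S])
  moreover have "enat s < enat (2 * t)"
    by (simp add: t_def)
  ultimately have S_diam: "enat s < diam S"
    by (rule less_le_trans[rotated])
  obtain y z where yz: "y \<in> verts S" "z \<in> verts S" "hop S y z = s"
    by (rule geodesic_of_length_exists[OF S less_imp_le[OF S_diam]])
  then have "z \<in> sphere S s y"
    by (simp add: sphere_iff_hop[OF S])
  then have local: "locally_distance_transitive (Aut \<Sigma>\<lparr>carrier := G\<rparr>) act S s \<longleftrightarrow>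
      (\<forall>v\<in>verts S. \<forall>i\<in>{1..s}. transitive_on {g \<in> G. act g v = v} act (sphere S i v))"
    using yz(1) by (auto simp: locally_distance_transitive_def stabilizer_def)
  have "arcs \<Sigma> t \<noteq> {}"
    by (rule geodesic_arc_exists[OF connected uw(1,2)]) (use uw(3) in auto)
  then have arc: "arc_transitive (Aut \<Sigma>\<lparr>carrier := G\<rparr>) (\<lambda>g. g) \<Sigma> t \<longleftrightarrow> (\<forall>i\<in>{1..t}. arc_trans i)"
    by (simp add: arc_transitive_def)
  have "(\<forall>v\<in>verts S. \<forall>i\<in>{1..s}. transitive_on {g \<in> G. act g v = v} act (sphere S i v)) \<longleftrightarrow>
      (\<forall>i\<in>{1..t}. arc_trans i)" (is "?spheres \<longleftrightarrow> ?arcs")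
  proof
    assume ?spheres
    then show ?arcs
      using arc_transitive_if_sphere_transitive[of s] assms(4) diam unfolding t_def by auto
  next
    assume ?arcs
    then show ?spheres
      using sphere_transitive_if_arc_transitive[of s] unfolding t_def by auto
  qed
  then show ?thesis
    using S_diam by (simp add: local arc t)
qed

end
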